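(* The space $l_\infty^{G}(\Delta_G)$ is a Banach space (in the geometric sense) with respect to the norm $\|\cdot\|^G_{\Delta_G}$ given by $\|x\|^G_{\Delta_G}=|x_1|^G\oplus\|\Delta_G x\|^G_\infty$.
   Context: Geometric complex numbers: $\mathbb{C}(G)=\{e^z: z\in\mathbb{C}\}$, where the generator $z\mapsto e^z$ is treated as a bijection from $\mathbb{C}$ onto $\mathbb{C}(G)$ with inverse $\ln$ (so an element of $\mathbb{C}(G)$ determines its exponent $z$). Operations: $e^z\oplus e^w=e^{z+w}$, $e^z\ominus e^w=e^{z-w}$, $e^z\odot e^w=e^{zw}$. $(\mathbb{C}(G),\oplus,\odot)$ is a field with geometric zero $1=e^0$ and geometric identity $e=e^1$. Geometric modulus: $|e^z|^G=e^{|z|}$, a real number $\ge 1$. On real numbers of the form $e^t$, $t\in\mathbb{R}$, the order and suprema are the usual ones, and $\oplus,\odot$ are given by the same formulas. $\omega(G)$ is the set of all sequences $x=(x_k)_{k\ge 1}$ with $x_k\in\mathbb{C}(G)$, a vector space over $\mathbb{C}(G)$ under coordinatewise $\oplus$ and scalar multiplication $\alpha\odot(x_k)=(\alpha\odot x_k)$; its zero vector is $(1,1,1,\dots)$. $l_\infty^G=\{x\in\omega(G): \sup_k|x_k|^G<\infty\}$ with $\|x\|^G_\infty=\sup_k|x_k|^G$. For $x\in\omega(G)$, $\Delta_G x=(x_k\ominus x_{k+1})_{k\ge1}$, and $l_\infty^G(\Delta_G)=\{x\in\omega(G):\Delta_G x\in l_\infty^G\}$. A (geometric) norm on a vector space $X$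 over $\mathbb{C}(G)$ is a map $\|\cdot\|:X\to[1,\infty)$ such that $\|x\|=1$ iff $x$ is the zero vector, $\|x\oplus y\|\le\|x\|\oplus\|y\|$, and $\|\alpha\odot x\|=|\alpha|^G\odot\|x\|$. A sequence $(x_n)$ in $X$ is Cauchy if $\|x_n\ominus x_m\|\to1$ as $n,m\to\infty$, and converges to $x$ if $\|x_n\ominus x\|\to1$. $X$ is a Banach space if every Cauchy sequence converges to an element of $X$. *)

theory Defs
  imports Complex_Main "HOL-Library.Function_Algebras"
begin

text \<open>
  The complex exponential is not injective, yet an element of \<open>\<complex>(G)\<close> is meant to determine
  its exponent. So \<open>\<complex>(G)\<close> is a fresh copy of the complex numbers: \<open>gexp z\<close> stands for \<open>e\<^sup>z\<close>,
  and \<open>gln\<close> for the inverse of this generator.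
\<close>

datatype gcomplex = gexp (gln: complex)

text \<open>
  The field operations of the type class are the geometric ones: \<open>+\<close>, \<open>-\<close>, \<open>*\<close> on type
  \<open>gcomplex\<close> are \<open>\<oplus>\<close>, \<open>\<ominus>\<close>, \<open>\<odot>\<close>. In particular the class constant \<open>0\<close> is the
  geometric zero \<open>e\<^sup>0\<close> (the number one), and the class constant \<open>1\<close> is the geometric identity \<open>e\<^sup>1\<close>.
\<close>

instantiation gcomplex :: field
begin

definition zero_gcomplex :: gcomplex where "0 = gexp 0"
definition one_gcomplex :: gcomplex where "1 = gexp 1"
definition plus_gcomplex :: "gcomplex \<Rightarrow> gcomplex \<Rightarrow> gcomplex"
  where "x + y = gexp (gln x + gln y)"
definition minus_gcomplex :: "gcomplex \<Rightarrow> gcomplex \<Rightarrow> gcomplex"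
  where "x - y = gexp (gln x - gln y)"
definition uminus_gcomplex :: "gcomplex \<Rightarrow> gcomplex"
  where "- x = gexp (- gln x)"
definition times_gcomplex :: "gcomplex \<Rightarrow> gcomplex \<Rightarrow> gcomplex"
  where "x * y = gexp (gln x * gln y)"
definition inverse_gcomplex :: "gcomplex \<Rightarrow> gcomplex"
  where "inverse x = gexp (inverse (gln x))"
definition divide_gcomplex :: "gcomplex \<Rightarrow> gcomplex \<Rightarrow> gcomplex"
  where "x div y = gexp (gln x / gln y)"

instance
proof
  show "inverse a * a = 1" if "a \<noteq> 0" for a :: gcomplex
    using that by (cases a) (simp add: zero_gcomplex_def one_gcomplex_def inverse_gcomplex_def times_gcomplex_def)
qed (simp_all add: zero_gcomplex_def one_gcomplex_def plus_gcomplex_def minus_gcomplex_def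
      uminus_gcomplex_def times_gcomplex_def inverse_gcomplex_def divide_gcomplex_def
      algebra_simps divide_inverse)

end

text \<open>Geometric addition and multiplication of real numbers \<open>e\<^sup>t\<close>; only meaningful for positive arguments.\<close>

definition gadd :: "real \<Rightarrow> real \<Rightarrow> real"  (infixl \<open>\<oplus>\<^sub>G\<close> 65)
  where "a \<oplus>\<^sub>G b = exp (ln a + ln b)"

definition gmult :: "real \<Rightarrow> real \<Rightarrow> real"  (infixl \<open>\<odot>\<^sub>G\<close> 70)
  where "a \<odot>\<^sub>G b = exp (ln a * ln b)"

definition gmod :: "gcomplex \<Rightarrow> real"
  where "gmod x = exp (cmod (gln x))"

text \<open>
  The geometric norm takes ordinary real values in \<open>[1, \<infinity>)\<close>, and its limits are ordinary limits
  of real sequences. The vector space is a linear subspace \<open>X\<close> of an ambient vector space over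
  \<open>\<complex>(G)\<close>; the class operations of the ambient type \<open>'a\<close> are the vector space's \<open>\<oplus>\<close>, \<open>\<ominus>\<close> and zero vector.
\<close>

locale geometric_normed_space = vector_space scale
  for scale :: "gcomplex \<Rightarrow> 'a::ab_group_add \<Rightarrow> 'a" +
  fixes X :: "'a set" and nrm :: "'a \<Rightarrow> real"
  assumes subspace_carrier: "subspace X"
    and nrm_ge_one: "x \<in> X \<Longrightarrow> 1 \<le> nrm x"
    and nrm_eq_one_iff: "x \<in> X \<Longrightarrow> nrm x = 1 \<longleftrightarrow> x = 0"
    and nrm_triangle: "x \<in> X \<Longrightarrow> y \<in> X \<Longrightarrow> nrm (x + y) \<le> nrm x \<oplus>\<^sub>G nrm y"
    and nrm_scale: "x \<in> X \<Longrightarrow> nrm (scale c x) = gmod c \<odot>\<^sub>G nrm x"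

definition geometric_Cauchy :: "('a::ab_group_add \<Rightarrow> real) \<Rightarrow> (nat \<Rightarrow> 'a) \<Rightarrow> bool"
  where "geometric_Cauchy nrm x \<longleftrightarrow>
    ((\<lambda>(n, m). nrm (x n - x m)) \<longlongrightarrow> 1) (sequentially \<times>\<^sub>F sequentially)"

definition geometric_converges_to :: "('a::ab_group_add \<Rightarrow> real) \<Rightarrow> (nat \<Rightarrow> 'a) \<Rightarrow> 'a \<Rightarrow> bool"
  where "geometric_converges_to nrm x l \<longleftrightarrow> (\<lambda>n. nrm (x n - l)) \<longlonglongrightarrow> 1"

locale geometric_banach_space = geometric_normed_space +
  assumes complete:
    "(\<And>n. x n \<in> X) \<Longrightarrow> geometric_Cauchy nrm x \<Longrightarrow> \<exists>l\<in>X. geometric_converges_to nrm x l"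

text \<open>
  A sequence \<open>(x\<^sub>k)\<close>, \<open>k \<ge> 1\<close>, is a function on \<open>nat\<close> with the index shifted by one: \<open>x 0\<close> is \<open>x\<^sub>1\<close>.
  So \<open>\<omega>(G)\<close> is the whole type, with the pointwise addition of \<^theory>\<open>HOL-Library.Function_Algebras\<close>.
\<close>

type_synonym gseq = "nat \<Rightarrow> gcomplex"

definition gseq_scale :: "gcomplex \<Rightarrow> gseq \<Rightarrow> gseq"
  where "gseq_scale c x = (\<lambda>k. c * x k)"

definition linf_G :: "gseq set"
  where "linf_G = {x. bdd_above (range (\<lambda>k. gmod (x k)))}"

definition norm_inf_G :: "gseq \<Rightarrow> real"
  where "norm_inf_G x = (SUP k. gmod (x k))"

definition Delta_G :: "gseq \<Rightarrow> gseq"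
  where "Delta_G x = (\<lambda>k. x k - x (Suc k))"

definition linf_Delta_G :: "gseq set"
  where "linf_Delta_G = {x. Delta_G x \<in> linf_G}"

definition norm_Delta_G :: "gseq \<Rightarrow> real"
  where "norm_Delta_G x = gmod (x 0) \<oplus>\<^sub>G norm_inf_G (Delta_G x)"

end

theory Submission imports Defs begin

text \<open>
  Taking logarithms turns the geometric norm into the ordinary norm
  \<open>\<bar>z\<^sub>1\<bar> + sup\<^sub>k \<bar>z\<^sub>k - z\<^sub>k\<^sub>+\<^sub>1\<bar>\<close> of the sequence \<open>z\<close> of exponents. Telescoping bounds the
  \<open>k\<close>-th coordinate by \<open>k\<close> times the norm, so a Cauchy sequence converges coordinatewise, and
  letting \<open>m \<rightarrow> \<infinity>\<close> in the coordinatewise bounds on \<open>x\<^sub>n - x\<^sub>m\<close> gives convergence in norm.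
\<close>

section \<open>Exponents and the geometric supremum norm\<close>

lemma gln_simps [simp]:
  "gln 0 = 0" "gln 1 = 1" "gln (x + y) = gln x + gln y" "gln (x - y) = gln x - gln y"
  "gln (- x) = - gln x" "gln (x * y) = gln x * gln y"
  by (simp_all add: zero_gcomplex_def one_gcomplex_def plus_gcomplex_def minus_gcomplex_def
      uminus_gcomplex_def times_gcomplex_def)

lemma gseq_scale_apply [simp]: "gseq_scale c x k = c * x k"
  by (simp add: gseq_scale_def)

lemma gln_eq_0_iff [simp]: "gln x = 0 \<longleftrightarrow> x = 0"
  by (cases x) (simp add: zero_gcomplex_def)

lemma ln_gmod [simp]: "ln (gmod x) = cmod (gln x)"
  by (simp add: gmod_def)

lemma linf_G_iff: "x \<in> linf_G \<longleftrightarrow> (\<exists>B. \<forall>k. cmod (gln (x k)) \<le> B)"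
proof
  assume "x \<in> linf_G"
  then obtain M where M: "exp (cmod (gln (x k))) \<le> M" for k
    by (auto simp: linf_G_def bdd_above_def gmod_def)
  \<comment> \<open>Since t + 1 \<le> exp t, the bound \<open>M\<close> on the exponentials already
    bounds the exponents.\<close>
  have "cmod (gln (x k)) \<le> M" for k
    using exp_ge_add_one_self[of "cmod (gln (x k))"] M[of k] by linarith
  then show "\<exists>B. \<forall>k. cmod (gln (x k)) \<le> B" by blast
next
  assume "\<exists>B. \<forall>k. cmod (gln (x k)) \<le> B"
  then obtain B where "cmod (gln (x k)) \<le> B" for k by blast
  then show "x \<in> linf_G"
    by (auto simp: linf_G_def gmod_def intro!: bdd_aboveI[of _ "exp B"])
qed

lemma gmod_le_norm_inf_G: "x \<in> linf_G \<Longrightarrow> gmod (x k) \<le> norm_inf_G x"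
  unfolding norm_inf_G_def linf_G_def by (intro cSUP_upper) auto

text \<open>Keeps the supremum in the range where \<open>ln\<close> is monotone and
  nonnegative.\<close>

lemma norm_inf_G_ge_one:
  assumes "x \<in> linf_G"
  shows "1 \<le> norm_inf_G x"
proof -
  have "1 \<le> gmod (x 0)" by (simp add: gmod_def)
  with gmod_le_norm_inf_G[OF assms, of 0] show ?thesis by linarith
qed

lemma cmod_gln_le_ln_norm_inf_G:
  assumes "x \<in> linf_G"
  shows "cmod (gln (x k)) \<le> ln (norm_inf_G x)"
proof -
  have "ln (gmod (x k)) \<le> ln (norm_inf_G x)"
    using gmod_le_norm_inf_G[OF assms] norm_inf_G_ge_one[OF assms]
    by (intro ln_mono) (auto simp: gmod_def)
  then show ?thesis by simp
qed

text \<open>With \<open>cmod_gln_le_ln_norm_inf_G\<close> this makes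
  \<open>ln (norm_inf_G x)\<close> the least upper bound of the moduli of the exponents, so suprema
  can be handled by coordinatewise estimates.\<close>

lemma ln_norm_inf_G_le:
  assumes "\<And>k. cmod (gln (x k)) \<le> B"
  shows "ln (norm_inf_G x) \<le> B"
proof -
  have "x \<in> linf_G" using assms by (auto simp: linf_G_iff)
  then have "0 < norm_inf_G x" using norm_inf_G_ge_one[of x] by linarith
  moreover have "norm_inf_G x \<le> exp B"
    unfolding norm_inf_G_def using assms by (intro cSUP_least) (auto simp: gmod_def)
  ultimately show ?thesis by (metis ln_mono ln_exp)
qed

section \<open>Differences and the coordinate bounds they give\<close>

lemma Delta_G_simps [simp]:
  "Delta_G (x + y) = Delta_G x + Delta_G y" "Delta_G (x - y) = Delta_G x - Delta_G y"
  "Delta_G (gseq_scale c x) = gseq_scale c (Delta_G x)" "Delta_G 0 = 0"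
  by (auto simp: Delta_G_def gseq_scale_def fun_eq_iff algebra_simps)

lemma linf_Delta_G_iff: "x \<in> linf_Delta_G \<longleftrightarrow> Delta_G x \<in> linf_G"
  by (simp add: linf_Delta_G_def)

lemma linf_Delta_GI:
  assumes "\<And>k. cmod (gln (Delta_G x k)) \<le> B"
  shows "x \<in> linf_Delta_G"
  using assms by (auto simp: linf_Delta_G_iff linf_G_iff)

lemma ln_norm_Delta_G:
  "ln (norm_Delta_G x) = cmod (gln (x 0)) + ln (norm_inf_G (Delta_G x))"
  by (simp add: norm_Delta_G_def gadd_def)

text \<open>The outer \<open>gadd\<close> makes the norm an exponential for every \<open>x\<close>;
  this carries estimates of its logarithm back to the norm.\<close>

lemma norm_Delta_G_eq_exp: "norm_Delta_G x = exp (ln (norm_Delta_G x))"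
  by (simp add: norm_Delta_G_def gadd_def)

lemma ln_norm_Delta_G_le:
  assumes "cmod (gln (x 0)) \<le> A" and "\<And>k. cmod (gln (Delta_G x k)) \<le> B"
  shows "ln (norm_Delta_G x) \<le> A + B"
  using assms(1) ln_norm_inf_G_le[of "Delta_G x" B, OF assms(2)] by (simp add: ln_norm_Delta_G)

lemma cmod_gln_Delta_G_le:
  assumes "x \<in> linf_Delta_G"
  shows "cmod (gln (Delta_G x k)) \<le> ln (norm_inf_G (Delta_G x))"
  using assms cmod_gln_le_ln_norm_inf_G by (simp add: linf_Delta_G_iff)

lemma ln_norm_inf_G_Delta_nonneg:
  assumes "x \<in> linf_Delta_G"
  shows "0 \<le> ln (norm_inf_G (Delta_G x))"
  using assms by (simp add: linf_Delta_G_iff norm_inf_G_ge_one)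

text \<open>The first coordinate and each of the \<open>k\<close> differences leading to
  \<open>x k\<close> cost at most one norm each, whence the factor \<open>Suc k\<close>. This yields
  definiteness as well as coordinatewise Cauchy sequences.\<close>

lemma cmod_gln_le_ln_norm_Delta_G:
  assumes "x \<in> linf_Delta_G"
  shows "cmod (gln (x k)) \<le> real (Suc k) * ln (norm_Delta_G x)"
proof (induction k)
  case 0
  then show ?case using ln_norm_inf_G_Delta_nonneg[OF assms] by (simp add: ln_norm_Delta_G)
next
  case (Suc k)
  have "gln (x (Suc k)) = gln (x k) - gln (Delta_G x k)" by (simp add: Delta_G_def)
  then have "cmod (gln (x (Suc k))) \<le> cmod (gln (x k)) + cmod (gln (Delta_G x k))"
    by (metis norm_triangle_ineq4)
  moreover have "cmod (gln (Delta_G x k)) \<le> ln (norm_Delta_G x)"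
    using cmod_gln_Delta_G_le[OF assms, of k] by (simp add: ln_norm_Delta_G add_increasing)
  ultimately show ?case using Suc by (simp add: algebra_simps)
qed

section \<open>The vector space and the norm axioms\<close>

interpretation gseq: vector_space gseq_scale
  by unfold_locales (auto simp: gseq_scale_def fun_eq_iff algebra_simps)

lemma subspace_linf_Delta_G: "gseq.subspace linf_Delta_G"
proof (rule gseq.subspaceI)
  show "0 \<in> linf_Delta_G" by (rule linf_Delta_GI[of _ 0]) simp
next
  fix x y assume "x \<in> linf_Delta_G" "y \<in> linf_Delta_G"
  then show "x + y \<in> linf_Delta_G"
    by (intro linf_Delta_GI[of _ "ln (norm_inf_G (Delta_G x)) + ln (norm_inf_G (Delta_G y))"])
      (auto intro!: norm_triangle_mono cmod_gln_Delta_G_le)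
next
  fix c x assume "x \<in> linf_Delta_G"
  then show "gseq_scale c x \<in> linf_Delta_G"
    by (intro linf_Delta_GI[of _ "cmod (gln c) * ln (norm_inf_G (Delta_G x))"])
      (auto simp: norm_mult intro!: mult_left_mono cmod_gln_Delta_G_le)
qed

lemma ln_norm_inf_G_scale:
  assumes "x \<in> linf_G"
  shows "ln (norm_inf_G (gseq_scale c x)) = cmod (gln c) * ln (norm_inf_G x)"
proof (rule antisym)
  show *: "ln (norm_inf_G (gseq_scale c x)) \<le> cmod (gln c) * ln (norm_inf_G x)"
    by (intro ln_norm_inf_G_le)
      (auto simp: norm_mult intro!: mult_left_mono cmod_gln_le_ln_norm_inf_G assms)
  have bd: "gseq_scale c x \<in> linf_G"
    unfolding linf_G_iff
    by (intro exI[of _ "cmod (gln c) * ln (norm_inf_G x)"])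
      (auto simp: norm_mult intro!: mult_left_mono cmod_gln_le_ln_norm_inf_G assms)
  show "cmod (gln c) * ln (norm_inf_G x) \<le> ln (norm_inf_G (gseq_scale c x))"
  \<comment> \<open>For nonzero \<open>c\<close>, dividing the coordinate bounds of the scaled
    sequence by the modulus of \<open>gln c\<close> bounds those of \<open>x\<close>; for
    \<open>c = 0\<close> it is enough that the right side is nonnegative.\<close>
  proof (cases "c = 0")
    case True
    then show ?thesis using norm_inf_G_ge_one[OF bd] by simp
  next
    case False
    then have pos: "0 < cmod (gln c)" by simp
    have "cmod (gln (x k)) \<le> ln (norm_inf_G (gseq_scale c x)) / cmod (gln c)" for k
      using cmod_gln_le_ln_norm_inf_G[OF bd, of k] pos
      by (simp add: norm_mult pos_le_divide_eq mult.commute)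
    then have "ln (norm_inf_G x) \<le> ln (norm_inf_G (gseq_scale c x)) / cmod (gln c)"
      by (rule ln_norm_inf_G_le)
    then show ?thesis using pos by (simp add: pos_le_divide_eq mult.commute)
  qed
qed

lemma geometric_normed_space_linf_Delta_G:
  "geometric_normed_space gseq_scale linf_Delta_G norm_Delta_G"
proof
  show "gseq.subspace linf_Delta_G" by (rule subspace_linf_Delta_G)
next
  fix x assume x: "x \<in> linf_Delta_G"
  have nonneg: "0 \<le> ln (norm_Delta_G x)"
    using ln_norm_inf_G_Delta_nonneg[OF x] by (simp add: ln_norm_Delta_G)
  then show "1 \<le> norm_Delta_G x"
    by (subst norm_Delta_G_eq_exp) simp
  show "norm_Delta_G x = 1 \<longleftrightarrow> x = 0"
  proof
    assume "norm_Delta_G x = 1"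
    then have "cmod (gln (x k)) \<le> 0" for k
      using cmod_gln_le_ln_norm_Delta_G[OF x, of k] by simp
    then show "x = 0" by (simp add: fun_eq_iff)
  next
    assume "x = 0"
    then have "ln (norm_Delta_G x) \<le> 0 + 0" by (intro ln_norm_Delta_G_le) simp_all
    with nonneg show "norm_Delta_G x = 1" by (subst norm_Delta_G_eq_exp) simp
  qed
  show "norm_Delta_G (gseq_scale c x) = gmod c \<odot>\<^sub>G norm_Delta_G x" for c
  proof -
    have "ln (norm_Delta_G (gseq_scale c x)) = cmod (gln c) * ln (norm_Delta_G x)"
      using x by (simp add: ln_norm_Delta_G ln_norm_inf_G_scale linf_Delta_G_iff
          norm_mult distrib_left)
    then show ?thesis by (subst norm_Delta_G_eq_exp) (simp add: gmult_def)
  qed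
next
  fix x y assume "x \<in> linf_Delta_G" "y \<in> linf_Delta_G"
  then have "ln (norm_Delta_G (x + y)) \<le> (cmod (gln (x 0)) + cmod (gln (y 0)))
      + (ln (norm_inf_G (Delta_G x)) + ln (norm_inf_G (Delta_G y)))"
    by (intro ln_norm_Delta_G_le) (auto intro!: norm_triangle_mono cmod_gln_Delta_G_le)
  then show "norm_Delta_G (x + y) \<le> norm_Delta_G x \<oplus>\<^sub>G norm_Delta_G y"
    by (subst norm_Delta_G_eq_exp) (simp add: gadd_def ln_norm_Delta_G)
qed

section \<open>Completeness\<close>

lemma complete_linf_Delta_G:
  assumes X: "\<And>n. x n \<in> linf_Delta_G" and Cauchy: "geometric_Cauchy norm_Delta_G x"
  shows "\<exists>l\<in>linf_Delta_G. geometric_converges_to norm_Delta_G x l"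
proof -
  have diff: "x n - x m \<in> linf_Delta_G" for n m
    using X by (intro gseq.subspace_diff subspace_linf_Delta_G)
  have small: "\<exists>N. \<forall>n\<ge>N. \<forall>m\<ge>N. ln (norm_Delta_G (x n - x m)) < e" if "0 < e" for e
  proof -
    \<comment> \<open>The limit 1 lies below \<open>exp e\<close>, and a norm below
      \<open>exp e\<close> has logarithm below \<open>e\<close>.\<close>
    have "\<forall>\<^sub>F (n, m) in sequentially \<times>\<^sub>F sequentially. norm_Delta_G (x n - x m) < exp e"
      using order_tendstoD(2)[OF Cauchy[unfolded geometric_Cauchy_def], of "exp e"] that
      by (simp add: case_prod_unfold)
    then obtain N where N: "\<forall>n\<ge>N. \<forall>m\<ge>N. norm_Delta_G (x n - x m) < exp e"
      by (auto simp: eventually_prod_sequentially)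
    have "ln (norm_Delta_G (x n - x m)) < e" if "n \<ge> N" "m \<ge> N" for n m
      using N that by (metis norm_Delta_G_eq_exp exp_less_cancel_iff)
    then show ?thesis by blast
  qed
  have "Cauchy (\<lambda>n. gln (x n k))" for k
  proof (rule CauchyI)
    fix e :: real assume "0 < e"
    \<comment> \<open>The divisor cancels the factor of the coordinate bound; \<open>N\<close> may
      depend on \<open>k\<close>.\<close>
    then obtain N where N: "\<forall>n\<ge>N. \<forall>m\<ge>N. ln (norm_Delta_G (x n - x m)) < e / real (Suc k)"
      using small[of "e / real (Suc k)"] by auto
    have "cmod (gln (x m k) - gln (x n k)) < e" if "m \<ge> N" "n \<ge> N" for m n
    proof -
      have "cmod (gln (x m k) - gln (x n k)) \<le> real (Suc k) * ln (norm_Delta_G (x m - x n))"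
        using cmod_gln_le_ln_norm_Delta_G[OF diff, of m n k] by simp
      also have "\<dots> < real (Suc k) * (e / real (Suc k))"
        using N that by (intro mult_strict_left_mono) auto
      finally show ?thesis by simp
    qed
    then show "\<exists>M. \<forall>m\<ge>M. \<forall>n\<ge>M. cmod (gln (x m k) - gln (x n k)) < e" by blast
  qed
  then have "\<exists>z. (\<lambda>n. gln (x n k)) \<longlonglongrightarrow> z" for k
    by (simp add: Cauchy_convergent_iff convergent_def)
  then obtain z where z: "\<And>k. (\<lambda>n. gln (x n k)) \<longlonglongrightarrow> z k" by metis
  define l where "l = (\<lambda>k. gexp (z k))"
  \<comment> \<open>The first coordinate and the differences contribute one \<open>e\<close> each.
    Here \<open>N\<close> does not depend on \<open>k\<close>, so the difference bounds pass to the
    supremum; they also give membership of \<open>x n - l\<close> before that of \<open>l\<close> is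
    known.\<close>
  have tail: "\<exists>N. \<forall>n\<ge>N. x n - l \<in> linf_Delta_G \<and> ln (norm_Delta_G (x n - l)) \<le> 2 * e"
    if "0 < e" for e
  proof -
    obtain N where N: "\<And>n m. n \<ge> N \<Longrightarrow> m \<ge> N \<Longrightarrow> ln (norm_Delta_G (x n - x m)) < e"
      using small[OF \<open>0 < e\<close>] by blast
    have "x n - l \<in> linf_Delta_G \<and> ln (norm_Delta_G (x n - l)) \<le> 2 * e" if n: "n \<ge> N" for n
    proof -
      have fst: "cmod (gln ((x n - l) 0)) \<le> e"
      proof (rule Lim_bounded)
        show "(\<lambda>m. cmod (gln ((x n - x m) 0))) \<longlonglongrightarrow> cmod (gln ((x n - l) 0))"
          by (auto simp: l_def intro!: tendsto_intros z)
        \<comment> \<open>At index 0 the factor \<open>Suc k\<close> is 1.\<close>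
        show "\<forall>m\<ge>N. cmod (gln ((x n - x m) 0)) \<le> e"
          using cmod_gln_le_ln_norm_Delta_G[OF diff, of n _ 0] N[OF n]
          by (fastforce intro: order.trans less_imp_le)
      qed
      have Delta: "cmod (gln (Delta_G (x n - l) k)) \<le> e" for k
      proof (rule Lim_bounded)
        show "(\<lambda>m. cmod (gln (Delta_G (x n - x m) k))) \<longlonglongrightarrow> cmod (gln (Delta_G (x n - l) k))"
          by (auto simp: Delta_G_def l_def intro!: tendsto_intros z)
        have "cmod (gln (Delta_G (x n - x m) k)) \<le> ln (norm_Delta_G (x n - x m))" for m
          unfolding ln_norm_Delta_G
          using cmod_gln_Delta_G_le[OF diff, of n m k] by (intro add_increasing) auto
        then show "\<forall>m\<ge>N. cmod (gln (Delta_G (x n - x m) k)) \<le> e"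
          using N[OF n] by (blast intro: order.trans less_imp_le)
      qed
      show ?thesis
        using linf_Delta_GI[OF Delta] ln_norm_Delta_G_le[OF fst Delta] by simp
    qed
    then show ?thesis by blast
  qed
  \<comment> \<open>Any positive number would do in place of 1: \<open>l\<close> is the difference
    of \<open>x N\<close> and \<open>x N - l\<close>, both in the subspace.\<close>
  obtain N where N: "x N - l \<in> linf_Delta_G" using tail[of 1] by auto
  have l: "l \<in> linf_Delta_G"
    using gseq.subspace_diff[OF subspace_linf_Delta_G X[of N] N] by simp
  have "(\<lambda>n. ln (norm_Delta_G (x n - l))) \<longlonglongrightarrow> 0"
  proof (rule LIMSEQ_I)
    fix e :: real assume "0 < e"
    \<comment> \<open>Taking \<open>e / 4\<close> leaves room for the strict inequality that passing
      to the limit has weakened.\<close>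
    then obtain N where "\<And>n. n \<ge> N \<Longrightarrow> x n - l \<in> linf_Delta_G \<and> ln (norm_Delta_G (x n - l)) \<le> e / 2"
      using tail[of "e / 4"] by auto
    moreover have "0 \<le> ln (norm_Delta_G y)" if "y \<in> linf_Delta_G" for y
      using ln_norm_inf_G_Delta_nonneg[OF that] by (simp add: ln_norm_Delta_G)
    ultimately have "norm (ln (norm_Delta_G (x n - l)) - 0) < e" if "n \<ge> N" for n
      using that \<open>0 < e\<close> by fastforce
    then show "\<exists>N. \<forall>n\<ge>N. norm (ln (norm_Delta_G (x n - l)) - 0) < e" by blast
  qed
  from tendsto_exp[OF this] have "(\<lambda>n. norm_Delta_G (x n - l)) \<longlonglongrightarrow> 1"
    by (simp flip: norm_Delta_G_eq_exp)
  with l show ?thesis by (auto simp: geometric_converges_to_def)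
qed

theorem theorem2p2:
  "geometric_banach_space gseq_scale linf_Delta_G norm_Delta_G"
  by (intro geometric_banach_space.intro geometric_normed_space_linf_Delta_G
      geometric_banach_space_axioms.intro complete_linf_Delta_G)

end
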